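(* Let $M$ be a group-embeddable monoid. Then there exists a graph $\Gamma^*$ such that $\operatorname{Bi}(\Gamma^* )\cong M$.
   Context: A monoid is group-embeddable if it is isomorphic to a submonoid of some group. Graphs are simple: undirected, loopless, unlabelled, possibly infinite. A bimorphism of a graph $\Gamma$ is a bijection $\beta: V\Gamma\to V\Gamma$ such that whenever $\{u,v\}$ is an edge of $\Gamma$, $\{u\beta,v\beta\}$ is also an edge (non-edges may be sent to edges). $\operatorname{Bi}(\Gamma)$ denotes the monoid of all bimorphisms of $\Gamma$ under composition. *)

theory Defs
  imports "HOL-Algebra.Group" "HOL-Algebra.Bij"
begin

(* HOL cannot quantify over types inside a formula, so the type of the elements of the
   ambient group is a parameter. As a hypothesis with 'g a free type variable,
   "group_embeddable TYPE('g) M" places no bound on the size of that group. *)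
definition group_embeddable :: "'g itself \<Rightarrow> ('a, 'm) monoid_scheme \<Rightarrow> bool" where
  "group_embeddable _ M \<longleftrightarrow>
     monoid M \<and>
     (\<exists>(G :: 'g monoid) H. group G \<and> submonoid H G \<and> M \<cong> G\<lparr>carrier := H\<rparr>)"

definition simple_graph :: "'v set \<Rightarrow> 'v set set \<Rightarrow> bool" where
  "simple_graph V E \<longleftrightarrow> (\<forall>e\<in>E. \<exists>u\<in>V. \<exists>v\<in>V. u \<noteq> v \<and> e = {u, v})"

definition bimorphisms :: "'v set \<Rightarrow> 'v set set \<Rightarrow> ('v \<Rightarrow> 'v) set" where
  "bimorphisms V E =
     {\<beta> \<in> Bij V. \<forall>u\<in>V. \<forall>v\<in>V. {u, v} \<in> E \<longrightarrow> {\<beta> u, \<beta> v} \<in> E}"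

(* Maps act on the right: the product of \<beta> and \<gamma> is first \<beta>, then \<gamma>. *)
definition Bi :: "'v set \<Rightarrow> 'v set set \<Rightarrow> ('v \<Rightarrow> 'v) monoid" where
  "Bi V E =
     \<lparr>carrier = bimorphisms V E,
      mult = (\<lambda>\<beta> \<gamma>. compose V \<gamma> \<beta>),
      one = (\<lambda>x\<in>V. x)\<rparr>"

lemma monoid_Bi: "monoid (Bi V E)"
proof (rule monoidI)
  fix x y assume "x \<in> carrier (Bi V E)" "y \<in> carrier (Bi V E)"
  then have "x \<in> bimorphisms V E" "y \<in> bimorphisms V E"
    by (simp_all add: Bi_def)
  moreover from this have "x \<in> V \<rightarrow> V"
    by (simp add: bimorphisms_def Bij_imp_funcset)
  ultimately have "compose V y x \<in> bimorphisms V E"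
    by (auto simp: bimorphisms_def compose_Bij compose_eq Pi_iff)
  then show "x \<otimes>\<^bsub>Bi V E\<^esub> y \<in> carrier (Bi V E)"
    by (simp add: Bi_def)
next
  show "\<one>\<^bsub>Bi V E\<^esub> \<in> carrier (Bi V E)"
    by (simp add: Bi_def bimorphisms_def id_Bij)
next
  fix x y z
  assume "x \<in> carrier (Bi V E)" "y \<in> carrier (Bi V E)" "z \<in> carrier (Bi V E)"
  then have "x \<in> V \<rightarrow> V"
    by (simp add: Bi_def bimorphisms_def Bij_imp_funcset)
  then show "x \<otimes>\<^bsub>Bi V E\<^esub> y \<otimes>\<^bsub>Bi V E\<^esub> z = x \<otimes>\<^bsub>Bi V E\<^esub> (y \<otimes>\<^bsub>Bi V E\<^esub> z)"
    by (simp add: Bi_def compose_assoc)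
next
  fix x assume "x \<in> carrier (Bi V E)"
  then have x: "x \<in> V \<rightarrow> V" "x \<in> extensional V"
    by (simp_all add: Bi_def bimorphisms_def Bij_imp_funcset Bij_imp_extensional)
  then show "\<one>\<^bsub>Bi V E\<^esub> \<otimes>\<^bsub>Bi V E\<^esub> x = x"
    by (simp add: Bi_def)
  from x show "x \<otimes>\<^bsub>Bi V E\<^esub> \<one>\<^bsub>Bi V E\<^esub> = x"
    by (simp add: Bi_def)
qed

end

theory Submission
  imports Defs "HOL-Algebra.Generated_Groups"
begin

text \<open>
  Embed the monoid as a submonoid \<open>H\<close> of a group \<open>G\<close> generated by \<open>H\<close>, and well-order \<open>G\<close>. Take
  two copies \<open>Src x\<close>, \<open>Tgt x\<close> of \<open>G\<close>, joined by a perfect matching, a vertex \<open>Arc x y\<close> adjacent to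
  \<open>Src x\<close> and \<open>Tgt y\<close> for every pair, and a third copy \<open>Col t\<close> of \<open>G\<close> whose vertices serve as
  colours: \<open>Arc x y\<close> is adjacent to \<open>Col t\<close> iff \<open>t \<le> y x\<inverse>\<close>. Finally \<open>Src x\<close> is adjacent to all
  colours iff \<open>x \<in> H\<close>.

  Suppose that a bimorphism respects the four kinds of vertices. It acts on both copies of \<open>G\<close> by
  the same bijection \<open>a\<close> and sends \<open>Arc x y\<close> to \<open>Arc (a x) (a y)\<close>. Well-foundedness of the order
  forces the colours to be fixed and \<open>a y (a x)\<inverse> = y x\<inverse>\<close>, so \<open>a\<close> is right multiplication by
  \<open>m = a 1\<close>. As \<open>1 \<in> H\<close>, adjacency to the colours gives \<open>m \<in> H\<close>; conversely \<open>H m \<subseteq> H\<close> for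
  \<open>m \<in> H\<close>, so right multiplication by \<open>m\<close> is a bimorphism.

  The kinds are enforced by adding a clique on 8 vertices, larger than any other clique and hence
  invariant, and joining each kind to its own subset of the clique. These four subsets are chosen
  such that no nontrivial permutation of the clique maps each of them into one of them.
\<close>

section \<open>Forcing four vertex types with a finite clique\<close>

text \<open>An antichain of sets of distinct sizes which separates the points of \<open>{..<8}\<close>.\<close>

definition core_nbrs :: "nat \<Rightarrow> nat set" where
  "core_nbrs i =
     (if i = 0 then {1,6} else if i = 1 then {0,3,6} else if i = 2 then {0,1,2,5} else {0,1,2,3,4})"

lemma core_nbrs_subset: "core_nbrs i \<subseteq> {..<8}"
  by (auto simp: core_nbrs_def)

lemma finite_core_nbrs [simp]: "finite (core_nbrs i)"
  by (simp add: core_nbrs_def)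

lemma less_4_cases: "(i::nat) < 4 \<longleftrightarrow> i = 0 \<or> i = 1 \<or> i = 2 \<or> i = 3"
  by auto

lemma core_nbrs_antichain:
  "i < 4 \<Longrightarrow> j < 4 \<Longrightarrow> core_nbrs i \<subseteq> core_nbrs j \<Longrightarrow> i = j"
  by (auto simp: less_4_cases core_nbrs_def)

lemma card_core_nbrs: "i < 4 \<Longrightarrow> card (core_nbrs i) = i + 2"
  by (auto simp: less_4_cases core_nbrs_def)

text \<open>Used for a clique with two points outside the core: they have different types, so at
  most 3 core vertices see both. With at most four outside points this leaves 7 vertices.\<close>

lemma card_core_nbrs_Int:
  assumes "i < 4" "j < 4" "i \<noteq> j"
  shows "card (core_nbrs i \<inter> core_nbrs j) \<le> 3"
  using assms by (auto simp: less_4_cases core_nbrs_def)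

text \<open>The numbers 0 to 7 have eight different membership patterns; 7 lies in none of the
  sets.\<close>

lemma core_nbrs_separating:
  assumes "k < 8" "l < 8" "\<And>i. i < 4 \<Longrightarrow> k \<in> core_nbrs i \<longleftrightarrow> l \<in> core_nbrs i"
  shows "k = l"
proof -
  have "k \<in> {0,1,2,3,4,5,6,7}" "l \<in> {0,1,2,3,4,5,6,7}"
    using assms(1,2) by auto
  then show ?thesis
    using assms(3)[of 0] assms(3)[of 1] assms(3)[of 2] assms(3)[of 3]
    by (simp add: core_nbrs_def) (elim disjE; simp)
qed

text \<open>Downward induction on the size: a larger set is already known to be invariant, so a smaller one
  cannot be mapped into it.\<close>

lemma core_nbrs_rigid:
  assumes inj: "inj_on p {..<8}"
    and dom: "\<And>i. i < 4 \<Longrightarrow> \<exists>j<4. p ` core_nbrs i \<subseteq> core_nbrs j"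
    and i: "i < 4"
  shows "p ` core_nbrs i = core_nbrs i"
  using i
proof (induction "4 - i" arbitrary: i rule: less_induct)
  case less
  obtain j where j: "j < 4" "p ` core_nbrs i \<subseteq> core_nbrs j"
    using dom less.prems by blast
  have card: "card (p ` core_nbrs i) = card (core_nbrs i)"
    by (rule card_image) (rule inj_on_subset[OF inj core_nbrs_subset])
  then have "card (core_nbrs i) \<le> card (core_nbrs j)"
    using j card_mono[of "core_nbrs j" "p ` core_nbrs i"] by simp
  then have "i \<le> j"
    using card_core_nbrs less.prems j by simp
  have "j = i"
  proof (rule ccontr)
    assume "j \<noteq> i"
    with \<open>i \<le> j\<close> have "p ` core_nbrs j = core_nbrs j"
      using less.hyps j less.prems by (metis diff_less_mono2 le_neq_implies_less)
    \<comment> \<open>\<open>p\<close> maps \<open>core_nbrs j\<close> onto itself, so by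
      injectivity it sends nothing else into that set.\<close>
    then have "core_nbrs i \<subseteq> core_nbrs j"
      using j(2) inj_on_image_mem_iff[OF inj _ core_nbrs_subset] core_nbrs_subset by blast
    then show False
      using core_nbrs_antichain less.prems j \<open>j \<noteq> i\<close> by blast
  qed
  then show ?case
    using j card card_subset_eq[of "core_nbrs i" "p ` core_nbrs i"] by simp
qed

text \<open>All four sets are invariant under the injective \<open>p\<close>, so \<open>k\<close>
  and \<open>p k\<close> have the same membership pattern.\<close>

lemma core_nbrs_rigid_pointwise:
  assumes inj: "inj_on p {..<8}" and into: "p ` {..<8} \<subseteq> {..<8}"
    and dom: "\<And>i. i < 4 \<Longrightarrow> \<exists>j<4. p ` core_nbrs i \<subseteq> core_nbrs j"
    and k: "k < 8"
  shows "p k = k"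
proof (rule core_nbrs_separating)
  show "p k < 8" using into k by auto
  fix i :: nat assume "i < 4"
  then have "p ` core_nbrs i = core_nbrs i"
    using core_nbrs_rigid[OF inj dom] by blast
  then show "p k \<in> core_nbrs i \<longleftrightarrow> k \<in> core_nbrs i"
    using inj_on_image_mem_iff[OF inj _ core_nbrs_subset, of k i] k by simp
qed (fact k)

text \<open>By \<open>type_neq\<close> a clique has at most one point of each type, hence at most
  four in \<open>X\<close>. By \<open>type_onto\<close> each set \<open>core_nbrs i\<close> occurs
  as a neighbourhood in the core, as rigidity requires.\<close>

locale typed_graph =
  fixes X :: "'x set" and R :: "'x \<Rightarrow> 'x \<Rightarrow> bool" and \<tau> :: "'x \<Rightarrow> nat"
  assumes type_onto: "i < 4 \<Longrightarrow> \<exists>x\<in>X. \<tau> x = i"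
    and type_less: "x \<in> X \<Longrightarrow> \<tau> x < 4"
    and sym: "R x y \<Longrightarrow> R y x"
    and type_neq: "R x y \<Longrightarrow> \<tau> x \<noteq> \<tau> y"
begin

fun adj :: "nat + 'x \<Rightarrow> nat + 'x \<Rightarrow> bool" where
  "adj (Inl i) (Inl j) \<longleftrightarrow> i \<noteq> j"
| "adj (Inl i) (Inr x) \<longleftrightarrow> i \<in> core_nbrs (\<tau> x)"
| "adj (Inr x) (Inl i) \<longleftrightarrow> i \<in> core_nbrs (\<tau> x)"
| "adj (Inr x) (Inr y) \<longleftrightarrow> R x y"

definition core :: "(nat + 'x) set" where "core = Inl ` {..<8}"
definition V :: "(nat + 'x) set" where "V = core \<union> Inr ` X"
definition E :: "(nat + 'x) set set" where "E = {{u, v} |u v. u \<in> V \<and> v \<in> V \<and> adj u v}"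

lemma adj_sym: "adj u v \<Longrightarrow> adj v u"
  by (cases u; cases v) (auto intro: sym)

lemma not_adj_refl: "\<not> adj u u"
  using type_neq by (cases u) auto

lemma edge_iff: "{u, v} \<in> E \<longleftrightarrow> u \<in> V \<and> v \<in> V \<and> adj u v"
  unfolding E_def by (auto simp: doubleton_eq_iff intro: adj_sym)

lemma simple_graph: "simple_graph V E"
  unfolding simple_graph_def
proof
  fix e assume "e \<in> E"
  then obtain u v where "e = {u, v}" "u \<in> V" "v \<in> V" "adj u v" by (auto simp: E_def)
  moreover from this have "u \<noteq> v" using not_adj_refl by blast
  ultimately show "\<exists>u\<in>V. \<exists>v\<in>V. u \<noteq> v \<and> e = {u, v}" by blast
qed

lemma Inl_in_V: "Inl k \<in> V \<longleftrightarrow> k < 8"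
  and Inr_in_V: "Inr x \<in> V \<longleftrightarrow> x \<in> X"
  by (auto simp: V_def core_def)

lemma bimorphisms_iff:
  "f \<in> bimorphisms V E \<longleftrightarrow> f \<in> Bij V \<and> (\<forall>u\<in>V. \<forall>v\<in>V. adj u v \<longrightarrow> adj (f u) (f v))"
  unfolding bimorphisms_def edge_iff using Bij_imp_funcset by blast

text \<open>A single vertex outside the core has at most 5 core neighbours, giving a clique of size
  at most 6. Two or more such vertices give at most 4 + 3 = 7.\<close>

lemma clique_in_core:
  assumes S: "S \<subseteq> V" "card S = 8" and clique: "\<And>u v. u \<in> S \<Longrightarrow> v \<in> S \<Longrightarrow> u \<noteq> v \<Longrightarrow> adj u v"
  shows "S = core"
proof -
  define K where "K = Inl -` S"
  define Y where "Y = Inr -` S"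
  have S_eq: "S = Inl ` K \<union> Inr ` Y"
  proof (intro equalityI subsetI)
    fix u assume "u \<in> S" then show "u \<in> Inl ` K \<union> Inr ` Y"
      by (cases u) (auto simp: K_def Y_def)
  qed (auto simp: K_def Y_def)
  have "finite S" using S(2) by (metis card.infinite zero_neq_numeral)
  then have fin: "finite K" "finite Y"
    by (auto simp: K_def Y_def finite_vimageI)
  have "Y \<subseteq> X" "K \<subseteq> {..<8}"
    using S(1) by (auto simp: K_def Y_def Inr_in_V Inl_in_V dest!: subsetD)
  have cardS: "card K + card Y = 8"
    using S(2) fin unfolding S_eq by (subst (asm) card_Un_disjoint) (auto simp: card_image)
  have inj: "inj_on \<tau> Y"
    using clique type_neq unfolding inj_on_def Y_def by fastforce
  have "\<tau> ` Y \<subseteq> {..<4}" using type_less \<open>Y \<subseteq> X\<close> by auto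
  then have "card Y \<le> 4"
    using inj by (metis card_image card_lessThan card_mono finite_lessThan)
  have nbr: "K \<subseteq> core_nbrs (\<tau> y)" if "y \<in> Y" for y
  proof
    fix k assume "k \<in> K"
    then have "adj (Inr y) (Inl k)" using clique[of "Inr y" "Inl k"] that by (simp add: K_def Y_def)
    then show "k \<in> core_nbrs (\<tau> y)" by simp
  qed
  have "Y = {}"
  proof (rule ccontr)
    assume "Y \<noteq> {}"
    then obtain y where y: "y \<in> Y" by blast
    show False
    proof (cases "Y = {y}")
      case True
      have "card K \<le> card (core_nbrs (\<tau> y))"
        using nbr y by (intro card_mono) auto
      then show False
        using True cardS card_core_nbrs[of "\<tau> y"] type_less[of y] \<open>Y \<subseteq> X\<close> y by auto
    next
      case False
      with y obtain z where z: "z \<in> Y" "z \<noteq> y" by blast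
      have "card K \<le> card (core_nbrs (\<tau> y) \<inter> core_nbrs (\<tau> z))"
        using nbr y z by (intro card_mono) auto
      also have "\<dots> \<le> 3"
        using inj y z \<open>Y \<subseteq> X\<close> type_less by (intro card_core_nbrs_Int) (auto dest: inj_onD)
      finally show False
        using \<open>card Y \<le> 4\<close> cardS by simp
    qed
  qed
  then have "K = {..<8}"
    using cardS \<open>K \<subseteq> {..<8}\<close> by (intro card_subset_eq) auto
  then show ?thesis
    using S_eq \<open>Y = {}\<close> by (simp add: core_def)
qed

text \<open>Edges are preserved and \<open>f\<close> is injective, so the image of the core is again
  a clique on 8 vertices.\<close>

lemma bimorphism_core:
  assumes f: "f \<in> bimorphisms V E"
  shows "f ` core = core"
proof (rule clique_in_core)
  have bij: "bij_betw f V V" and hom: "\<And>u v. u \<in> V \<Longrightarrow> v \<in> V \<Longrightarrow> adj u v \<Longrightarrow> adj (f u) (f v)"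
    using f by (auto simp: bimorphisms_iff Bij_def)
  have "core \<subseteq> V" by (simp add: V_def)
  then show "f ` core \<subseteq> V"
    using bij by (auto simp: bij_betw_def)
  have "inj_on f core"
    using bij \<open>core \<subseteq> V\<close> by (auto simp: bij_betw_def intro: inj_on_subset)
  then show "card (f ` core) = 8"
    by (simp add: card_image core_def)
  fix u v assume "u \<in> f ` core" "v \<in> f ` core" "u \<noteq> v"
  then show "adj u v"
    using \<open>core \<subseteq> V\<close> by (force simp: core_def intro!: hom)
qed

text \<open>Edge preservation yields only inclusions between images of neighbourhoods in the core.
  Rigidity turns these into the identity on the core, after which the antichain property makes types
  invariant.\<close>

lemma bimorphism_typed:
  assumes f: "f \<in> bimorphisms V E"
  obtains g where "bij_betw g X X"
    and "\<And>x. x \<in> X \<Longrightarrow> f (Inr x) = Inr (g x)" and "\<And>k. k < 8 \<Longrightarrow> f (Inl k) = Inl k"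
    and "\<And>x. x \<in> X \<Longrightarrow> \<tau> (g x) = \<tau> x"
    and "\<And>x y. x \<in> X \<Longrightarrow> y \<in> X \<Longrightarrow> R x y \<Longrightarrow> R (g x) (g y)"
proof -
  have bij: "bij_betw f V V" and hom: "\<And>u v. u \<in> V \<Longrightarrow> v \<in> V \<Longrightarrow> adj u v \<Longrightarrow> adj (f u) (f v)"
    using f by (auto simp: bimorphisms_iff Bij_def)
  have inj: "inj_on f V" using bij by (simp add: bij_betw_def)
  have "core \<subseteq> V" by (simp add: V_def)
  have X_eq: "Inr ` X = V - core" by (auto simp: V_def core_def)
  have "f ` (V - core) = f ` V - f ` core"
    by (rule inj_on_image_set_diff[OF inj]) (use \<open>core \<subseteq> V\<close> in auto)
  then have imX: "f ` Inr ` X = Inr ` X"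
    unfolding X_eq bimorphism_core[OF f] bij_betw_imp_surj_on[OF bij] .
  define p where "p k = projl (f (Inl k))" for k
  define g where "g x = projr (f (Inr x))" for x
  have p: "f (Inl k) = Inl (p k) \<and> p k < 8" if "k < 8" for k
  proof -
    have "f (Inl k) \<in> Inl ` {..<8}"
      using bimorphism_core[OF f] that unfolding core_def by blast
    then show ?thesis by (auto simp: p_def)
  qed
  have g: "f (Inr x) = Inr (g x) \<and> g x \<in> X" if "x \<in> X" for x
  proof -
    have "f (Inr x) \<in> Inr ` X" using imX that by blast
    then show ?thesis by (auto simp: g_def)
  qed
  have p_inj: "inj_on p {..<8}"
  proof (rule inj_onI)
    fix k l assume "k \<in> {..<8}" "l \<in> {..<8}" "p k = p l"
    then show "k = l"
      using p[of k] p[of l] inj_onD[OF inj, of "Inl k" "Inl l"] by (simp add: Inl_in_V)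
  qed
  have g_inj: "inj_on g X"
  proof (rule inj_onI)
    fix x y assume "x \<in> X" "y \<in> X" "g x = g y"
    then show "x = y"
      using g[of x] g[of y] inj_onD[OF inj, of "Inr x" "Inr y"] by (simp add: Inr_in_V)
  qed
  have "Inr ` g ` X = (Inr ` X :: (nat + 'x) set)"
    using imX g by (simp add: image_image)
  then have "g ` X = X"
    by (simp add: inj_image_eq_iff)
  have sub: "p ` core_nbrs (\<tau> x) \<subseteq> core_nbrs (\<tau> (g x))" if "x \<in> X" for x
  proof
    fix l assume "l \<in> p ` core_nbrs (\<tau> x)"
    then obtain k where k: "k \<in> core_nbrs (\<tau> x)" "l = p k" by blast
    then have "k < 8" using core_nbrs_subset by auto
    then have "adj (f (Inr x)) (f (Inl k))"
      using k that by (intro hom) (auto simp: Inl_in_V Inr_in_V)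
    then show "l \<in> core_nbrs (\<tau> (g x))"
      using p[OF \<open>k < 8\<close>] g[OF that] k by simp
  qed
  have dom: "\<exists>j<4. p ` core_nbrs i \<subseteq> core_nbrs j" if i: "i < 4" for i
  proof -
    obtain x where x: "x \<in> X" "\<tau> x = i" using type_onto[OF i] by blast
    then show ?thesis using sub[of x] type_less[of "g x"] g[of x] by blast
  qed
  have p_id: "p k = k" if "k < 8" for k
    using core_nbrs_rigid_pointwise[OF p_inj _ dom that] p by auto
  show thesis
  proof
    show "bij_betw g X X"
      using g_inj \<open>g ` X = X\<close> by (simp add: bij_betw_def)
    show "f (Inr x) = Inr (g x)" if "x \<in> X" for x using g that by simp
    show "f (Inl k) = Inl k" if "k < 8" for k using p p_id that by simp
    show "\<tau> (g x) = \<tau> x" if "x \<in> X" for x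
    proof -
      have "p ` core_nbrs (\<tau> x) = core_nbrs (\<tau> x)"
        using core_nbrs_rigid[OF p_inj dom] type_less that by blast
      then show ?thesis
        using core_nbrs_antichain[of "\<tau> x" "\<tau> (g x)"] sub[OF that] g[OF that] type_less that
        by simp
    qed
    show "R (g x) (g y)" if "x \<in> X" "y \<in> X" "R x y" for x y
      using hom[of "Inr x" "Inr y"] that g by (simp add: Inr_in_V)
  qed
qed

section \<open>Extending maps of \<open>X\<close> by the identity on the core\<close>

definition lift :: "('x \<Rightarrow> 'x) \<Rightarrow> nat + 'x \<Rightarrow> nat + 'x" where
  "lift g = (\<lambda>u\<in>V. map_sum id g u)"

lemma lift_Inl: "k < 8 \<Longrightarrow> lift g (Inl k) = Inl k"
  and lift_Inr: "x \<in> X \<Longrightarrow> lift g (Inr x) = Inr (g x)"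
  by (simp_all add: lift_def Inl_in_V Inr_in_V)

lemma V_cases:
  assumes "u \<in> V"
  obtains k where "u = Inl k" "k < 8" | x where "u = Inr x" "x \<in> X"
  using assms by (auto simp: V_def core_def)

lemma lift_bimorphism:
  assumes g: "bij_betw g X X" and type: "\<And>x. x \<in> X \<Longrightarrow> \<tau> (g x) = \<tau> x"
    and hom: "\<And>x y. x \<in> X \<Longrightarrow> y \<in> X \<Longrightarrow> R x y \<Longrightarrow> R (g x) (g y)"
  shows "lift g \<in> bimorphisms V E"
  unfolding bimorphisms_iff
proof (intro conjI ballI impI)
  have "bij_betw (lift g) V V"
    unfolding bij_betw_def
  proof (intro conjI inj_onI)
    fix u v assume "u \<in> V" "v \<in> V" "lift g u = lift g v"
    then show "u = v"
      using g by (auto elim!: V_cases simp: lift_Inl lift_Inr bij_betw_def dest: inj_onD)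
  next
    have "lift g ` V = lift g ` core \<union> lift g ` Inr ` X" by (simp add: V_def image_Un)
    also have "lift g ` core = core"
      by (auto simp: core_def lift_Inl image_iff)
    also have "lift g ` Inr ` X = Inr ` g ` X"
      by (simp add: image_image lift_Inr)
    also have "g ` X = X" using g by (simp add: bij_betw_def)
    finally show "lift g ` V = V" by (simp add: V_def)
  qed
  then show "lift g \<in> Bij V"
    by (simp add: Bij_def lift_def)
next
  fix u v assume "u \<in> V" "v \<in> V" "adj u v"
  then show "adj (lift g u) (lift g v)"
    by (auto elim!: V_cases simp: lift_Inl lift_Inr type hom)
qed

lemma eq_lift:
  assumes "f \<in> extensional V" "\<And>k. k < 8 \<Longrightarrow> f (Inl k) = Inl k"
    and "\<And>x. x \<in> X \<Longrightarrow> f (Inr x) = Inr (g x)"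
  shows "f = lift g"
proof (rule extensionalityI[OF assms(1)])
  show "lift g \<in> extensional V" by (simp add: lift_def)
  fix u assume "u \<in> V"
  then show "f u = lift g u"
    by (auto elim!: V_cases simp: assms lift_Inl lift_Inr)
qed

lemma compose_lift:
  assumes "g ` X \<subseteq> X"
  shows "compose V (lift h) (lift g) = lift (h \<circ> g)"
  using assms by (intro eq_lift) (auto simp: compose_def lift_Inl lift_Inr Inl_in_V Inr_in_V)

lemma lift_eqD: "lift g = lift h \<Longrightarrow> x \<in> X \<Longrightarrow> g x = h x"
  using lift_Inr by (metis sum.inject(2))

end

section \<open>A coloured Cayley graph\<close>

text \<open>Well-founded induction: if everything below \<open>s\<close> is fixed by both maps, the
  \<open>q\<close>-preimage \<open>u\<close> of \<open>s\<close> is not below \<open>s\<close>. By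
  \<open>mono\<close>, both \<open>p s\<close> and \<open>p u\<close> are at most
  \<open>q u = s\<close>. Smaller values are already taken by \<open>p\<close>, so
  \<open>p s = p u = s\<close> and \<open>u = s\<close>.\<close>

lemma well_order_bij_pair_id:
  assumes r: "well_order_on A r"
    and p: "bij_betw p A A" and q: "bij_betw q A A"
    and mono: "\<And>s t. s \<in> A \<Longrightarrow> t \<in> A \<Longrightarrow> (t, s) \<in> r \<Longrightarrow> (p t, q s) \<in> r"
    and s: "s \<in> A"
  shows "p s = s \<and> q s = s"
proof -
  have wf: "wf (r - Id)" and refl: "\<And>x. x \<in> A \<Longrightarrow> (x, x) \<in> r" and total: "total_on A r"
    and antisym: "antisym r"
    using r by (auto simp: well_order_on_def linear_order_on_def partial_order_on_def
        preorder_on_def refl_on_def)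
  have pA: "p x \<in> A" if "x \<in> A" for x using p that by (auto simp: bij_betw_def)
  have p_inj: "x = y" if "x \<in> A" "y \<in> A" "p x = p y" for x y
    using p that by (auto simp: bij_betw_def dest: inj_onD)
  show ?thesis
    using wf s
  proof (induction s rule: wf_induct_rule)
    case (less s)
    obtain u where u: "u \<in> A" "q u = s"
      using q less.prems by (metis bij_betw_def imageE)
    have least: "p x = s" if "x \<in> A" "(s, x) \<in> r" "(p x, s) \<in> r" for x
    proof (rule ccontr)
      assume "p x \<noteq> s"
      then have "p (p x) = p x" using less.IH[of "p x"] that pA by simp
      then have "p x = x" using p_inj pA that by blast
      then show False using that \<open>p x \<noteq> s\<close> antisymD[OF antisym, of s x] by auto
    qed
    have "(s, u) \<in> r"
    proof (rule ccontr)
      assume "(s, u) \<notin> r"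
      then have "(u, s) \<in> r" "u \<noteq> s"
        using total u(1) less.prems refl unfolding total_on_def by metis+
      then show False using less.IH[of u] u by simp
    qed
    then have "p s = s"
      using least[of s] mono[of u s] u less.prems refl by auto
    moreover have "p u = s"
      using least[of u] mono[of u u] u refl \<open>(s, u) \<in> r\<close> by auto
    ultimately have "u = s" using p_inj u less.prems by auto
    with \<open>p s = s\<close> u show ?case by simp
  qed
qed

datatype 'g point = Src 'g | Tgt 'g | Arc 'g 'g | Col 'g

fun kind :: "'g point \<Rightarrow> nat" where
  "kind (Src x) = 0" | "kind (Tgt x) = 1" | "kind (Arc x y) = 2" | "kind (Col t) = 3"

locale coloured_cayley = group G + submonoid H G for G (structure) and H +
  fixes r
  assumes r: "well_order_on (carrier G) r"
begin

fun link :: "'a point \<Rightarrow> 'a point \<Rightarrow> bool" where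
  "link (Src x) (Tgt y) \<longleftrightarrow> x = y"
| "link (Src x) (Arc y z) \<longleftrightarrow> x = y"
| "link (Tgt x) (Arc y z) \<longleftrightarrow> x = z"
| "link (Arc x y) (Col t) \<longleftrightarrow> (t, y \<otimes> inv x) \<in> r"
| "link (Src x) (Col t) \<longleftrightarrow> x \<in> H"
| "link _ _ \<longleftrightarrow> False"

definition points :: "'a point set" where "points = {p. set_point p \<subseteq> carrier G}"

lemma in_points [simp]:
  "Src x \<in> points \<longleftrightarrow> x \<in> carrier G" "Tgt x \<in> points \<longleftrightarrow> x \<in> carrier G"
  "Arc x y \<in> points \<longleftrightarrow> x \<in> carrier G \<and> y \<in> carrier G" "Col x \<in> points \<longleftrightarrow> x \<in> carrier G"
  by (auto simp: points_def)

text \<open>Allows the direction of \<open>link\<close> to be recovered from its symmetric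
  closure.\<close>

lemma kind_less: "link u v \<Longrightarrow> kind u < kind v"
  by (induction u v rule: link.induct) auto

sublocale typed_graph points "\<lambda>u v. link u v \<or> link v u" kind
proof
  fix i :: nat assume "i < 4"
  then consider "i = 0" | "i = 1" | "i = 2" | "i = 3" by linarith
  then show "\<exists>p\<in>points. kind p = i"
  proof cases
    case 1 then show ?thesis by (intro bexI[of _ "Src \<one>"]) auto
  next
    case 2 then show ?thesis by (intro bexI[of _ "Tgt \<one>"]) auto
  next
    case 3 then show ?thesis by (intro bexI[of _ "Arc \<one> \<one>"]) auto
  next
    case 4 then show ?thesis by (intro bexI[of _ "Col \<one>"]) auto
  qed
next
  fix p show "kind p < 4" by (cases p) auto
next
  fix u v assume "link u v \<or> link v u"
  then show "kind u \<noteq> kind v" using kind_less by fastforce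
qed auto

section \<open>Right multiplication acting on the points\<close>

fun act :: "'a \<Rightarrow> 'a point \<Rightarrow> 'a point" where
  "act m (Src x) = Src (x \<otimes> m)"
| "act m (Tgt x) = Tgt (x \<otimes> m)"
| "act m (Arc x y) = Arc (x \<otimes> m) (y \<otimes> m)"
| "act m (Col t) = Col t"

lemma kind_act [simp]: "kind (act m p) = kind p"
  by (cases p) auto

lemma act_in_points: "m \<in> carrier G \<Longrightarrow> p \<in> points \<Longrightarrow> act m p \<in> points"
  by (cases p) auto

lemma act_act:
  "m \<in> carrier G \<Longrightarrow> n \<in> carrier G \<Longrightarrow> p \<in> points \<Longrightarrow> act n (act m p) = act (m \<otimes> n) p"
  by (cases p) (auto simp: m_assoc)

lemma act_one: "p \<in> points \<Longrightarrow> act \<one> p = p"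
  by (cases p) auto

lemma bij_betw_act:
  assumes "m \<in> carrier G" shows "bij_betw (act m) points points"
  using assms
  by (intro bij_betw_byWitness[where f' = "act (inv m)"])
     (auto simp: act_act act_one act_in_points)

text \<open>The reason for colouring \<open>Arc x y\<close> by \<open>y \<otimes> inv x\<close>:
  right multiplication leaves colours alone.\<close>

lemma quotient_shift:
  assumes "x \<in> carrier G" "y \<in> carrier G" "m \<in> carrier G"
  shows "(y \<otimes> m) \<otimes> inv (x \<otimes> m) = y \<otimes> inv x"
proof -
  have "(y \<otimes> m) \<otimes> inv (x \<otimes> m) = (y \<otimes> m \<otimes> inv m) \<otimes> inv x"
    using assms by (simp add: inv_mult_group m_assoc[symmetric])
  also have "y \<otimes> m \<otimes> inv m = y"
    using assms by (simp add: m_assoc)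
  finally show ?thesis .
qed

text \<open>Edges from \<open>Src\<close> to \<open>Col\<close> survive because \<open>H\<close> is
  closed under products. Since \<open>x \<otimes> m \<in> H\<close> need not imply
  \<open>x \<in> H\<close>, non-edges may become edges.\<close>

lemma link_act:
  assumes "m \<in> H" "p \<in> points" "q \<in> points" "link p q"
  shows "link (act m p) (act m q)"
  using assms by (cases p; cases q) (auto simp: quotient_shift)

lemma lift_act: "m \<in> H \<Longrightarrow> lift (act m) \<in> bimorphisms V E"
  by (intro lift_bimorphism bij_betw_act) (auto intro: link_act)

lemma bimorphism_eq_lift_act:
  assumes f: "f \<in> bimorphisms V E"
  shows "\<exists>m\<in>H. f = lift (act m)"
proof -
  obtain g where g: "bij_betw g points points"
    and fg: "\<And>x. x \<in> points \<Longrightarrow> f (Inr x) = Inr (g x)" "\<And>k. k < 8 \<Longrightarrow> f (Inl k) = Inl k"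
    and kind: "\<And>x. x \<in> points \<Longrightarrow> kind (g x) = kind x"
    and hom: "\<And>x y. x \<in> points \<Longrightarrow> y \<in> points \<Longrightarrow> link x y \<or> link y x \<Longrightarrow>
      link (g x) (g y) \<or> link (g y) (g x)"
    using bimorphism_typed[OF f] by blast
  \<comment> \<open>A reversed image edge would contradict the preservation of kinds.\<close>
  have hom: "link (g x) (g y)" if "x \<in> points" "y \<in> points" "link x y" for x y
    using hom[of x y] kind[of x] kind[of y] kind_less[of x y] kind_less[of "g y" "g x"] that by auto
  have gpoints: "g x \<in> points" if "x \<in> points" for x
    using g that by (auto simp: bij_betw_def)
  have g_inj: "x = y" if "g x = g y" "x \<in> points" "y \<in> points" for x y
    using g that by (auto simp: bij_betw_def dest: inj_onD)
  have g_surj: "\<exists>x\<in>points. g x = y" if "y \<in> points" for y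
    using g that by (metis bij_betw_def imageE)
  have "\<exists>a. g (Src x) = Src a" if "x \<in> carrier G" for x
    using kind[of "Src x"] that by (cases "g (Src x)") auto
  then obtain a where a: "\<And>x. x \<in> carrier G \<Longrightarrow> g (Src x) = Src (a x)" by metis
  \<comment> \<open>The only \<open>Tgt\<close> neighbour of \<open>Src z\<close> is
    \<open>Tgt z\<close>, so both copies of the group move alike.\<close>
  have tgt: "g (Tgt x) = Tgt (a x)" if x: "x \<in> carrier G" for x
    using hom[of "Src x" "Tgt x"] kind[of "Tgt x"] a[OF x] x by (cases "g (Tgt x)") auto
  have arc: "g (Arc x y) = Arc (a x) (a y)" if "x \<in> carrier G" "y \<in> carrier G" for x y
    using hom[of "Src x" "Arc x y"] hom[of "Tgt y" "Arc x y"] kind[of "Arc x y"] a tgt that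
    by (cases "g (Arc x y)") auto
  have "\<exists>c. g (Col t) = Col c" if "t \<in> carrier G" for t
    using kind[of "Col t"] that by (cases "g (Col t)") auto
  then obtain c where c: "\<And>x. x \<in> carrier G \<Longrightarrow> g (Col x) = Col (c x)" by metis
  have a_closed: "a x \<in> carrier G" if "x \<in> carrier G" for x
    using gpoints[of "Src x"] a that by simp
  have bij_a: "bij_betw a (carrier G) (carrier G)"
    unfolding bij_betw_def
  proof (intro conjI inj_onI equalityI subsetI)
    fix x y assume "x \<in> carrier G" "y \<in> carrier G" "a x = a y"
    then show "x = y" using g_inj[of "Src x" "Src y"] a by simp
  next
    fix y assume "y \<in> carrier G"
    then obtain p where p: "p \<in> points" "g p = Src y" using g_surj[of "Src y"] by auto
    then show "y \<in> a ` carrier G"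
      using kind[of p] a by (cases p) auto
  qed (use a_closed in auto)
  have bij_c: "bij_betw c (carrier G) (carrier G)"
    unfolding bij_betw_def
  proof (intro conjI inj_onI equalityI subsetI)
    fix x y assume "x \<in> carrier G" "y \<in> carrier G" "c x = c y"
    then show "x = y" using g_inj[of "Col x" "Col y"] c by simp
  next
    fix y assume "y \<in> carrier G"
    then obtain p where p: "p \<in> points" "g p = Col y" using g_surj[of "Col y"] by auto
    then show "y \<in> c ` carrier G"
      using kind[of p] c by (cases p) auto
  next
    fix y assume "y \<in> c ` carrier G"
    then show "y \<in> carrier G" using gpoints[of "Col _"] c by force
  qed
  define m where "m = a \<one>"
  have m: "m \<in> carrier G" by (simp add: m_def a_closed)
  define q where "q s = a s \<otimes> inv m" for s
  have bij_q: "bij_betw q (carrier G) (carrier G)"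
  proof -
    have "bij_betw (\<lambda>x. x \<otimes> inv m) (carrier G) (carrier G)"
      using m by (intro bij_betw_byWitness[where f' = "\<lambda>x. x \<otimes> m"]) (auto simp: m_assoc)
    then show ?thesis
      using bij_betw_trans[OF bij_a] by (simp add: q_def[abs_def] comp_def)
  qed
  \<comment> \<open>The arc from \<open>\<one>\<close> to \<open>s\<close> has quotient
    \<open>s\<close>, and its image, from \<open>m\<close> to \<open>a s\<close>, has quotient
    \<open>q s\<close>.\<close>
  have mono: "(c t, q s) \<in> r" if "s \<in> carrier G" "t \<in> carrier G" "(t, s) \<in> r" for s t
    using hom[of "Arc \<one> s" "Col t"] that arc c by (simp add: q_def m_def)
  have id: "c s = s" "q s = s" if "s \<in> carrier G" for s
    using well_order_bij_pair_id[OF r bij_c bij_q mono that] by auto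
  have a_eq: "a s = s \<otimes> m" if "s \<in> carrier G" for s
    using id(2)[OF that] that m a_closed by (simp add: q_def inv_solve_right')
  \<comment> \<open>\<open>Src \<one>\<close> is adjacent to a colour since
    \<open>\<one> \<in> H\<close>; hence so is its image \<open>Src m\<close>.\<close>
  have "m \<in> H"
    using hom[of "Src \<one>" "Col \<one>"] a c by (simp add: m_def)
  moreover have "f = lift (act m)"
  proof (rule eq_lift)
    show "f \<in> extensional V" using f by (simp add: bimorphisms_iff Bij_imp_extensional)
    fix p assume "p \<in> points"
    then show "f (Inr p) = Inr (act m p)"
      unfolding fg(1)[OF \<open>p \<in> points\<close>] by (cases p) (auto simp: a tgt arc c a_eq id)
  qed (rule fg)
  ultimately show ?thesis by blast
qed

text \<open>Products in \<open>Bi\<close> apply the left factor first, which matches multiplying on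
  the right by \<open>m\<close> and then by \<open>n\<close>. The image of \<open>Src \<one>\<close>
  recovers \<open>m\<close>.\<close>

lemma iso_lift_act: "(\<lambda>m. lift (act m)) \<in> iso (G\<lparr>carrier := H\<rparr>) (Bi V E)"
proof (rule isoI)
  show "(\<lambda>m. lift (act m)) \<in> hom (G\<lparr>carrier := H\<rparr>) (Bi V E)"
  proof (rule homI)
    fix m n assume "m \<in> carrier (G\<lparr>carrier := H\<rparr>)" "n \<in> carrier (G\<lparr>carrier := H\<rparr>)"
    then have mn: "m \<in> carrier G" "n \<in> carrier G" by auto
    have "compose V (lift (act n)) (lift (act m)) = lift (act n \<circ> act m)"
      using mn by (intro compose_lift) (auto simp: act_in_points)
    also have "\<dots> = lift (act (m \<otimes> n))"
      by (rule eq_lift) (auto simp: lift_Inl lift_Inr act_act mn, simp add: lift_def)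
    finally show "lift (act (m \<otimes>\<^bsub>G\<lparr>carrier := H\<rparr>\<^esub> n)) = lift (act m) \<otimes>\<^bsub>Bi V E\<^esub> lift (act n)"
      by (simp add: Bi_def)
  qed (simp add: Bi_def lift_act)
  show "bij_betw (\<lambda>m. lift (act m)) (carrier (G\<lparr>carrier := H\<rparr>)) (carrier (Bi V E))"
    unfolding bij_betw_def
  proof (intro conjI inj_onI)
    fix m n assume mn: "m \<in> carrier (G\<lparr>carrier := H\<rparr>)" "n \<in> carrier (G\<lparr>carrier := H\<rparr>)"
      and eq: "lift (act m) = lift (act n)"
    from lift_eqD[OF eq, of "Src \<one>"] mn show "m = n" by simp
  next
    show "(\<lambda>m. lift (act m)) ` carrier (G\<lparr>carrier := H\<rparr>) = carrier (Bi V E)"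
      using lift_act bimorphism_eq_lift_act by (auto simp: Bi_def)
  qed
qed

end

section \<open>Relabelling vertices\<close>

lemma (in monoid) is_iso_sym:
  assumes "G \<cong> H"
  shows "H \<cong> G"
proof -
  obtain h where hom: "h \<in> hom G H" and bij: "bij_betw h (carrier G) (carrier H)"
    using assms by (auto simp: is_iso_def iso_def)
  let ?k = "inv_into (carrier G) h"
  have bij_k: "bij_betw ?k (carrier H) (carrier G)"
    by (rule bij_betw_inv_into[OF bij])
  have k: "?k x \<in> carrier G" "h (?k x) = x" if "x \<in> carrier H" for x
    using bij_betwE[OF bij_k] bij_betw_inv_into_right[OF bij] that by auto
  have "?k (x \<otimes>\<^bsub>H\<^esub> y) = ?k x \<otimes> ?k y" if "x \<in> carrier H" "y \<in> carrier H" for x y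
  proof (rule inv_into_f_eq)
    show "inj_on h (carrier G)" using bij by (simp add: bij_betw_def)
    show "h (?k x \<otimes> ?k y) = x \<otimes>\<^bsub>H\<^esub> y" using hom_mult[OF hom] k that by simp
  qed (simp add: k that)
  then have "?k \<in> hom H G" by (auto intro!: homI simp: k)
  with bij_k show ?thesis by (auto simp: is_iso_def iso_def)
qed

text \<open>Conjugation by \<open>h\<close> is the isomorphism. It moves the graph to a vertex type
  that depends only on the element type of the monoid.\<close>

lemma Bi_image_iso:
  assumes h: "inj_on h V" and graph: "simple_graph V E"
  shows "simple_graph (h ` V) ((`) h ` E)" and "Bi V E \<cong> Bi (h ` V) ((`) h ` E)"
proof -
  let ?E = "(`) h ` E"
  have edgeD: "\<exists>u\<in>V. \<exists>v\<in>V. u \<noteq> v \<and> e = {u, v}" if "e \<in> E" for e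
    using graph that by (simp add: simple_graph_def)
  show "simple_graph (h ` V) ?E"
    unfolding simple_graph_def
  proof
    fix e assume "e \<in> ?E"
    then obtain e' where "e' \<in> E" "e = h ` e'" by blast
    with edgeD obtain u v where "u \<in> V" "v \<in> V" "u \<noteq> v" "e = {h u, h v}" by force
    with h show "\<exists>u\<in>h ` V. \<exists>v\<in>h ` V. u \<noteq> v \<and> e = {u, v}"
      by (metis image_eqI inj_onD)
  qed
  have edge_iff: "{h u, h v} \<in> ?E \<longleftrightarrow> {u, v} \<in> E" if "u \<in> V" "v \<in> V" for u v
  proof
    assume "{h u, h v} \<in> ?E"
    then obtain e where e: "e \<in> E" "h ` {u, v} = h ` e" by auto
    \<comment> \<open>\<open>edgeD\<close> places \<open>e\<close> inside \<open>V\<close>, where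
      \<open>h\<close> is injective.\<close>
    then have "{u, v} = e"
      using inj_on_image_eq_iff[OF h, of "{u, v}" e] edgeD[of e] that by blast
    with e show "{u, v} \<in> E" by simp
  next
    assume "{u, v} \<in> E"
    then have "h ` {u, v} \<in> ?E" by (rule imageI)
    then show "{h u, h v} \<in> ?E" by simp
  qed
  define k where "k = inv_into V h"
  have kh [simp]: "k (h u) = u" if "u \<in> V" for u
    using h that by (simp add: k_def)
  define c where "c f = (\<lambda>w\<in>h ` V. h (f (k w)))" for f
  have c_app: "c f (h u) = h (f u)" if "u \<in> V" for f u
    using that by (simp add: c_def)
  have bij: "bij_betw h V (h ` V)" using h by (simp add: bij_betw_def)
  have bijk: "bij_betw k (h ` V) V" unfolding k_def by (rule bij_betw_inv_into[OF bij])
  have into: "f u \<in> V" if "f \<in> bimorphisms V E" "u \<in> V" for f u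
    using that Bij_imp_funcset unfolding bimorphisms_def by blast
  have c_in: "c f \<in> bimorphisms (h ` V) ?E" if f: "f \<in> bimorphisms V E" for f
  proof -
    have "bij_betw f V V" using f by (simp add: bimorphisms_def Bij_def)
    then have "bij_betw (\<lambda>w. h (f (k w))) (h ` V) (h ` V)"
      using bij_betw_trans[OF bij_betw_trans[OF bijk] bij] by (simp add: comp_def)
    then have "c f \<in> Bij (h ` V)"
      unfolding Bij_def c_def by (auto cong: bij_betw_cong)
    then show ?thesis
      using f into[OF f] by (auto simp: bimorphisms_def c_app edge_iff)
  qed
  have c_surj: "\<exists>f\<in>bimorphisms V E. c f = F" if F: "F \<in> bimorphisms (h ` V) ?E" for F
  proof -
    define f where "f = (\<lambda>u\<in>V. k (F (h u)))"
    have bF: "bij_betw F (h ` V) (h ` V)" using F by (simp add: bimorphisms_def Bij_def)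
    then have "bij_betw (\<lambda>u. k (F (h u))) V V"
      using bij_betw_trans[OF bij_betw_trans[OF bij] bijk] by (simp add: comp_def)
    then have fB: "f \<in> Bij V"
      unfolding Bij_def f_def by (auto cong: bij_betw_cong)
    have hf: "h (f u) = F (h u)" "f u \<in> V" if "u \<in> V" for u
    proof -
      have "F (h u) \<in> h ` V" using bF that by (auto simp: bij_betw_def)
      then show "h (f u) = F (h u)" "f u \<in> V" using that by (auto simp: f_def)
    qed
    have "{f u, f v} \<in> E" if "u \<in> V" "v \<in> V" "{u, v} \<in> E" for u v
    proof -
      have "{F (h u), F (h v)} \<in> ?E"
        using F that edge_iff by (simp add: bimorphisms_def)
      then show ?thesis using hf that edge_iff[of "f u" "f v"] by simp
    qed
    then have "f \<in> bimorphisms V E" using fB by (simp add: bimorphisms_def)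
    moreover have "c f = F"
    proof (rule extensionalityI[of _ "h ` V"])
      show "c f \<in> extensional (h ` V)" by (simp add: c_def)
      show "F \<in> extensional (h ` V)" using F by (simp add: bimorphisms_def Bij_def)
    qed (auto simp: c_app hf)
    ultimately show ?thesis by blast
  qed
  have "c \<in> iso (Bi V E) (Bi (h ` V) ?E)"
  proof (rule isoI)
    show "c \<in> hom (Bi V E) (Bi (h ` V) ?E)"
    proof (rule homI)
      fix f g assume "f \<in> carrier (Bi V E)" "g \<in> carrier (Bi V E)"
      then have "f \<in> bimorphisms V E" by (simp add: Bi_def)
      then have "c (compose V g f) = compose (h ` V) (c g) (c f)"
        by (intro extensionalityI[of _ "h ` V"]) (auto simp: c_app compose_def into, simp add: c_def)
      then show "c (f \<otimes>\<^bsub>Bi V E\<^esub> g) = c f \<otimes>\<^bsub>Bi (h ` V) ?E\<^esub> c g"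
        by (simp add: Bi_def)
    qed (simp add: Bi_def c_in)
    show "bij_betw c (carrier (Bi V E)) (carrier (Bi (h ` V) ?E))"
      unfolding bij_betw_def
    proof (intro conjI inj_onI)
      fix f g assume "f \<in> carrier (Bi V E)" "g \<in> carrier (Bi V E)" and eq: "c f = c g"
      then have fg: "f \<in> bimorphisms V E" "g \<in> bimorphisms V E" by (simp_all add: Bi_def)
      show "f = g"
      proof (rule extensionalityI[of _ V])
        show "f \<in> extensional V" "g \<in> extensional V"
          using fg by (auto simp: bimorphisms_def Bij_def)
        fix u assume u: "u \<in> V"
        then have "h (f u) = h (g u)" using eq c_app by metis
        then show "f u = g u" using h into fg u by (meson inj_onD)
      qed
    next
      show "c ` carrier (Bi V E) = carrier (Bi (h ` V) ?E)"
        using c_in c_surj by (force simp: Bi_def)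
    qed
  qed
  then show "Bi V E \<cong> Bi (h ` V) ?E" by (auto simp: is_iso_def)
qed

section \<open>Coding elements of a generated subgroup by words\<close>

context group
begin

text \<open>Exponent signs are natural numbers so that words over the monoid have the vertex type of
  the final graph.\<close>

fun word_value :: "('c \<Rightarrow> 'a) \<Rightarrow> ('c \<times> nat) list \<Rightarrow> 'a" where
  "word_value \<phi> [] = \<one>"
| "word_value \<phi> ((b, n) # w) = (if n = 0 then \<phi> b else inv (\<phi> b)) \<otimes> word_value \<phi> w"

lemma word_value_closed:
  "\<phi> ` B \<subseteq> carrier G \<Longrightarrow> fst ` set w \<subseteq> B \<Longrightarrow> word_value \<phi> w \<in> carrier G"
  by (induction w) auto

lemma word_value_append:
  assumes "\<phi> ` B \<subseteq> carrier G" "fst ` set v \<subseteq> B" "fst ` set w \<subseteq> B"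
  shows "word_value \<phi> (v @ w) = word_value \<phi> v \<otimes> word_value \<phi> w"
  using assms(2)
proof (induction v)
  case Nil
  then show ?case using word_value_closed[OF assms(1,3)] by simp
next
  case (Cons x v)
  obtain b n where x: "x = (b, n)" by fastforce
  have "\<phi> b \<in> carrier G" "word_value \<phi> v \<in> carrier G" "word_value \<phi> w \<in> carrier G"
    using Cons.prems assms word_value_closed[OF assms(1)] by (auto simp: x)
  then show ?case using Cons by (simp add: x m_assoc)
qed

lemma generate_words:
  assumes \<phi>: "\<phi> ` B \<subseteq> carrier G" and "g \<in> generate G (\<phi> ` B)"
  shows "\<exists>w. fst ` set w \<subseteq> B \<and> word_value \<phi> w = g"
  using assms(2)
proof (induction rule: generate.induct)
  case one
  show ?case by (rule exI[of _ "[]"]) simp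
next
  case (incl h)
  then obtain b where "b \<in> B" "h = \<phi> b" by blast
  then show ?case using \<phi> by (intro exI[of _ "[(b, 0)]"]) auto
next
  case (inv h)
  then obtain b where "b \<in> B" "h = \<phi> b" by blast
  then show ?case using \<phi> by (intro exI[of _ "[(b, 1)]"]) auto
next
  case (eng g h)
  then obtain v w where "fst ` set v \<subseteq> B" "word_value \<phi> v = g"
    and "fst ` set w \<subseteq> B" "word_value \<phi> w = h"
    by blast
  then show ?case using word_value_append[OF \<phi>] by (intro exI[of _ "v @ w"]) auto
qed

text \<open>Choosing one word for each element is injective. This codes the subgroup by lists over
  the generators' type, however large the ambient group is.\<close>

lemma generate_inj_words:
  fixes \<phi> :: "'c \<Rightarrow> 'a"
  assumes "\<phi> ` B \<subseteq> carrier G"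
  obtains e :: "'a \<Rightarrow> ('c \<times> nat) list" where "inj_on e (generate G (\<phi> ` B))"
proof
  have "generate G (\<phi> ` B) \<subseteq> range (word_value \<phi>)"
    using generate_words[OF assms] by blast
  then show "inj_on (inv_into UNIV (word_value \<phi>)) (generate G (\<phi> ` B))"
    by (rule inj_on_inv_into)
qed

end

text \<open>The parity of the second components tells the two lists apart.\<close>

definition merge :: "('b \<times> nat) list \<Rightarrow> ('b \<times> nat) list \<Rightarrow> ('b \<times> nat) list" where
  "merge v w = map (apsnd (\<lambda>n. 2 * n)) v @ map (apsnd (\<lambda>n. 2 * n + 1)) w"

lemma merge_inject: "merge v w = merge v' w' \<longleftrightarrow> v = v' \<and> w = w'"
proof
  assume eq: "merge v w = merge v' w'"
  have even: "filter (\<lambda>x. even (snd x)) (merge v w) = map (apsnd (\<lambda>n. 2 * n)) v"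
    and odd: "filter (\<lambda>x. odd (snd x)) (merge v w) = map (apsnd (\<lambda>n. 2 * n + 1)) w"
    for v w :: "('b \<times> nat) list"
    by (simp_all add: merge_def filter_map comp_def)
  have "inj (apsnd (\<lambda>n::nat. 2 * n) :: 'b \<times> nat \<Rightarrow> _)"
    "inj (apsnd (\<lambda>n::nat. 2 * n + 1) :: 'b \<times> nat \<Rightarrow> _)"
    by (auto simp: inj_on_def)
  then show "v = v' \<and> w = w'"
    using even[of v w] even[of v' w'] odd[of v w] odd[of v' w'] eq by (metis inj_map_eq_map)
qed simp

text \<open>The number in the head marks the kind of vertex; the offset 4 keeps core vertices apart
  from the kinds 0 to 3. \<open>undefined\<close> is a mere filler of the element type.\<close>

fun vertex_code :: "('g \<Rightarrow> ('b \<times> nat) list) \<Rightarrow> nat + 'g point \<Rightarrow> ('b \<times> nat) list" where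
  "vertex_code e (Inr (Src x)) = (undefined, 0) # e x"
| "vertex_code e (Inr (Tgt x)) = (undefined, 1) # e x"
| "vertex_code e (Inr (Arc x y)) = (undefined, 2) # merge (e x) (e y)"
| "vertex_code e (Inr (Col t)) = (undefined, 3) # e t"
| "vertex_code e (Inl k) = [(undefined, k + 4)]"

lemma (in coloured_cayley) inj_on_vertex_code:
  assumes "inj_on e (carrier G)"
  shows "inj_on (vertex_code e) V"
proof (rule inj_onI)
  fix u v assume uv: "u \<in> V" "v \<in> V" and eq: "vertex_code e u = vertex_code e v"
  have e: "e x = e y \<longleftrightarrow> x = y" if "x \<in> carrier G" "y \<in> carrier G" for x y
    using assms that by (auto dest: inj_onD)
  show "u = v"
  proof (cases u)
    case (Inl k)
    show ?thesis
    proof (cases v)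
      case (Inr p)
      then show ?thesis using eq Inl by (cases p) auto
    qed (use eq Inl in auto)
  next
    case u: (Inr p)
    show ?thesis
    proof (cases v)
      case (Inl k)
      then show ?thesis using eq u by (cases p) auto
    next
      case (Inr q)
      then show ?thesis
        using eq uv u by (cases p; cases q) (auto simp: Inr_in_V e merge_inject)
    qed
  qed
qed

theorem theorem1p1:
  fixes M :: "('a, 'm) monoid_scheme"
  assumes "group_embeddable TYPE('g) M"
  shows "\<exists>(V :: ('a \<times> nat) list set) E. simple_graph V E \<and> Bi V E \<cong> M"
proof -
  obtain G :: "'g monoid" and H where M: "monoid M" and G: "group G" and H: "submonoid H G"
    and "M \<cong> G\<lparr>carrier := H\<rparr>"
    using assms by (auto simp: group_embeddable_def)
  then obtain \<phi> where \<phi>: "\<phi> \<in> iso M (G\<lparr>carrier := H\<rparr>)" by (auto simp: is_iso_def)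
  then have \<phi>_image: "\<phi> ` carrier M = H" by (simp add: iso_def bij_betw_def)
  have "H \<subseteq> carrier G" using H by (rule submonoid.subset)
  \<comment> \<open>Replacing \<open>G\<close> by the subgroup generated by \<open>H\<close> makes
    every group element a word in images of elements of \<open>M\<close>.\<close>
  define K where "K = G\<lparr>carrier := generate G H\<rparr>"
  have "H \<subseteq> generate G H" by (auto intro: generate.incl)
  then have K: "group K" "submonoid H K" "K\<lparr>carrier := H\<rparr> = G\<lparr>carrier := H\<rparr>"
    using H group.generate_is_subgroup[OF G \<open>H \<subseteq> carrier G\<close>] subgroup.subgroup_is_group[OF _ G]
    by (auto simp: K_def submonoid_def)
  \<comment> \<open>The well-ordering theorem supplies the order on the colours.\<close>
  obtain r where r: "well_order_on (carrier K) r" using well_order_on by blast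
  interpret K: coloured_cayley K H r
    using K r by (intro coloured_cayley.intro coloured_cayley_axioms.intro)
  obtain e :: "'g \<Rightarrow> ('a \<times> nat) list" where "inj_on e (generate G H)"
    using group.generate_inj_words[OF G, of \<phi> "carrier M"] \<phi>_image \<open>H \<subseteq> carrier G\<close> by metis
  then have inj: "inj_on (vertex_code e) K.V"
    by (intro K.inj_on_vertex_code) (simp add: K_def)
  let ?V = "vertex_code e ` K.V" and ?E = "(`) (vertex_code e) ` K.E"
  have "M \<cong> Bi K.V K.E"
    using iso_trans[OF \<open>M \<cong> G\<lparr>carrier := H\<rparr>\<close>] K.iso_lift_act K(3) by (auto simp: is_iso_def)
  then have "M \<cong> Bi ?V ?E"
    using iso_trans Bi_image_iso(2)[OF inj K.simple_graph] by blast
  then have "Bi ?V ?E \<cong> M"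
    by (rule monoid.is_iso_sym[OF M])
  with Bi_image_iso(1)[OF inj K.simple_graph] show ?thesis by blast
qed

end
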